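(* Let $1\le k\le d$ be integers, let $r>0$, and put $s=\lfloor d/k\rfloor$. For $1\le i\le k$ let $\boldsymbol{\nu}_i\in\mathbb{R}^d$ be a vector with $\|\boldsymbol{\nu}_i\|_2=1$ whose entries in positions $(i-1)s+1,\dots,is$ are all equal to one another and whose other entries are $0$, and let $\boldsymbol{\mu}_i=r\,\boldsymbol{\nu}_i$. Let $P^{\mathrm{in}}=\frac1k\sum_{i=1}^k\mathcal{N}(\boldsymbol{\mu}_i,\mathbf{I}_d)$, let $P^{\mathrm{out}}=\mathcal{N}(\mathbf{0},\mathbf{I}_d)$, and let \[ D:=\mathbb{E}_{\mathbf{x}\sim P^{\mathrm{in}}}(ES(\mathbf{x}))-\mathbb{E}_{\mathbf{x}\sim P^{\mathrm{out}}}(ES(\mathbf{x})). \] Then \[ D=A_0-A_r+(k-1)\big(A_{\sqrt2\, r}-A_r\big). \]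
   Context: The score function is $ES(\mathbf{x})=\sum_{i=1}^k\exp\big(-\tfrac12\|\mathbf{x}-\boldsymbol{\mu}_i\|_2^2\big)$ for $\mathbf{x}\in\mathbb{R}^d$. For $\gamma\ge0$, $A_\gamma:=\mathbb{E}_{\mathbf{x}\sim\mathcal{N}(\boldsymbol{\mu},\mathbf{I}_d)}\big(\exp(-\tfrac12\|\mathbf{x}-\boldsymbol{\nu}\|_2^2)\big)$, where $\boldsymbol{\mu},\boldsymbol{\nu}\in\mathbb{R}^d$ are any two points with $\|\boldsymbol{\mu}-\boldsymbol{\nu}\|_2=\gamma$; by rotation and translation invariance this depends only on $\gamma$ (and $d$). *)

theory Defs
  imports "HOL-Probability.Probability"
begin

definition gaussian :: "real ^ 'n \<Rightarrow> (real ^ 'n) measure" where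
  "gaussian \<mu> = density lborel
     (\<lambda>x. ennreal ((2 * pi) powr (- real CARD('n) / 2) * exp (- (1/2) * (norm (x - \<mu>))\<^sup>2)))"

definition uniform_mixture :: "nat \<Rightarrow> (nat \<Rightarrow> (real ^ 'n) measure) \<Rightarrow> (real ^ 'n) measure" where
  "uniform_mixture k M =
     measure_of UNIV (sets borel) (\<lambda>A. ennreal (1 / real k) * (\<Sum>i=1..k. emeasure (M i) A))"

lemma sets_uniform_mixture [simp]: "sets (uniform_mixture k M) = sets borel"
  using sets.sigma_sets_eq[of borel] by (simp add: uniform_mixture_def)

text \<open>The set function above is a measure, so \<^const>\<open>measure_of\<close> does not collapse it to the
  zero measure.\<close>

lemma emeasure_uniform_mixture:
  fixes M :: "nat \<Rightarrow> (real ^ 'n) measure"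
  assumes "\<And>i. i \<in> {1..k} \<Longrightarrow> sets (M i) = sets borel" and "A \<in> sets borel"
  shows "emeasure (uniform_mixture k M) A = ennreal (1 / real k) * (\<Sum>i=1..k. emeasure (M i) A)"
proof (rule emeasure_measure_of[OF uniform_mixture_def])
  show "sets borel \<subseteq> Pow (UNIV :: (real ^ 'n) set)"
    by simp
  show "A \<in> sets (uniform_mixture k M)"
    using assms(2) by simp
  show "positive (sets (uniform_mixture k M))
          (\<lambda>A. ennreal (1 / real k) * (\<Sum>i=1..k. emeasure (M i) A))"
    by (simp add: positive_def)
  show "countably_additive (sets (uniform_mixture k M))
          (\<lambda>A. ennreal (1 / real k) * (\<Sum>i=1..k. emeasure (M i) A))"
  proof (rule countably_additiveI)
    fix B :: "nat \<Rightarrow> (real ^ 'n) set"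
    assume "range B \<subseteq> sets (uniform_mixture k M)" and disj: "disjoint_family B"
    then have B: "range B \<subseteq> sets (M i)" if "i \<in> {1..k}" for i
      using assms(1)[OF that] by simp
    have "(\<Sum>n. ennreal (1 / real k) * (\<Sum>i=1..k. emeasure (M i) (B n)))
        = ennreal (1 / real k) * (\<Sum>n. \<Sum>i=1..k. emeasure (M i) (B n))"
      by simp
    also have "(\<Sum>n. \<Sum>i=1..k. emeasure (M i) (B n)) = (\<Sum>i=1..k. \<Sum>n. emeasure (M i) (B n))"
      by (rule suminf_sum) simp
    also have "\<dots> = (\<Sum>i=1..k. emeasure (M i) (\<Union>n. B n))"
      using B disj by (intro sum.cong refl suminf_emeasure) auto
    finally show "(\<Sum>n. ennreal (1 / real k) * (\<Sum>i=1..k. emeasure (M i) (B n)))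
        = ennreal (1 / real k) * (\<Sum>i=1..k. emeasure (M i) (\<Union>n. B n))" .
  qed
qed

definition ES :: "nat \<Rightarrow> (nat \<Rightarrow> real ^ 'n) \<Rightarrow> real ^ 'n \<Rightarrow> real" where
  "ES k \<mu> x = (\<Sum>i=1..k. exp (- (1/2) * (norm (x - \<mu> i))\<^sup>2))"

lemma gaussian_kernel_expectation_cong:
  fixes \<mu> \<nu> \<mu>' \<nu>' :: "real ^ 'n"
  assumes "norm (\<mu> - \<nu>) = norm (\<mu>' - \<nu>')"
  shows "(\<integral>x. exp (- (1/2) * (norm (x - \<nu>))\<^sup>2) \<partial>gaussian \<mu>)
       = (\<integral>x. exp (- (1/2) * (norm (x - \<nu>'))\<^sup>2) \<partial>gaussian \<mu>')"
proof -
  let ?c = "(2 * pi) powr (- real CARD('n) / 2)"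
  have "(\<integral>x. exp (- (1/2) * (norm (x - \<nu>))\<^sup>2) \<partial>gaussian \<mu>)
      = ?c * exp (- (1/4) * (norm (\<mu> - \<nu>))\<^sup>2) * (\<integral>x. exp (- (norm (x :: real ^ 'n))\<^sup>2) \<partial>lborel)"
    for \<mu> \<nu> :: "real ^ 'n"
  proof -
    let ?m = "(1/2) *\<^sub>R (\<mu> + \<nu>)"
    have sq: "(1/2) * (norm (x - \<mu>))\<^sup>2 + (1/2) * (norm (x - \<nu>))\<^sup>2
        = (norm (x - ?m))\<^sup>2 + (1/4) * (norm (\<mu> - \<nu>))\<^sup>2" for x
      by (simp add: power2_norm_eq_inner algebra_simps inner_commute)
    have "(\<integral>x. exp (- (1/2) * (norm (x - \<nu>))\<^sup>2) \<partial>gaussian \<mu>)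
        = (\<integral>x. ?c * exp (- (1/2) * (norm (x - \<mu>))\<^sup>2) * exp (- (1/2) * (norm (x - \<nu>))\<^sup>2) \<partial>lborel)"
      unfolding gaussian_def by (subst integral_density) auto
    also have "\<dots> = (\<integral>x. ?c * exp (- (1/4) * (norm (\<mu> - \<nu>))\<^sup>2) * exp (- (norm (x - ?m))\<^sup>2) \<partial>lborel)"
    proof (rule Bochner_Integration.integral_cong[OF refl])
      fix x
      have "- (1/2) * (norm (x - \<mu>))\<^sup>2 + - (1/2) * (norm (x - \<nu>))\<^sup>2
          = - (1/4) * (norm (\<mu> - \<nu>))\<^sup>2 + - (norm (x - ?m))\<^sup>2"
        using sq[of x] by linarith
      then show "?c * exp (- (1/2) * (norm (x - \<mu>))\<^sup>2) * exp (- (1/2) * (norm (x - \<nu>))\<^sup>2)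
          = ?c * exp (- (1/4) * (norm (\<mu> - \<nu>))\<^sup>2) * exp (- (norm (x - ?m))\<^sup>2)"
        unfolding mult.assoc exp_add[symmetric] by (rule arg_cong)
    qed
    also have "\<dots> = ?c * exp (- (1/4) * (norm (\<mu> - \<nu>))\<^sup>2) * (\<integral>x. exp (- (norm (x - ?m))\<^sup>2) \<partial>lborel)"
      by simp
    also have "(\<integral>x. exp (- (norm (x - ?m))\<^sup>2) \<partial>lborel)
        = (\<integral>x. exp (- (norm (x :: real ^ 'n))\<^sup>2) \<partial>distr lborel borel ((+) (- ?m)))"
      by (subst integral_distr) auto
    also have "\<dots> = (\<integral>x. exp (- (norm (x :: real ^ 'n))\<^sup>2) \<partial>lborel)"
      by (simp add: lborel_distr_plus)
    finally show ?thesis .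
  qed
  then show ?thesis
    using assms by simp
qed

text \<open>The common value of the expectation over all pairs at distance \<open>\<gamma> \<ge> 0\<close>; for \<open>\<gamma> < 0\<close>
  the value is unspecified.  It depends on the dimension, hence the \<open>itself\<close> argument.\<close>

definition A_gamma :: "'n::finite itself \<Rightarrow> real \<Rightarrow> real" where
  "A_gamma _ \<gamma> = (THE a. \<forall>(\<mu> :: real ^ 'n) \<nu>. norm (\<mu> - \<nu>) = \<gamma> \<longrightarrow>
       a = (\<integral>x. exp (- (1/2) * (norm (x - \<nu>))\<^sup>2) \<partial>gaussian \<mu>))"

lemma A_gamma_eq:
  fixes \<mu> \<nu> :: "real ^ 'n"
  assumes "norm (\<mu> - \<nu>) = \<gamma>"
  shows "A_gamma TYPE('n) \<gamma> = (\<integral>x. exp (- (1/2) * (norm (x - \<nu>))\<^sup>2) \<partial>gaussian \<mu>)"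
  unfolding A_gamma_def
proof (rule the_equality)
  show "\<forall>(\<mu>' :: real ^ 'n) \<nu>'. norm (\<mu>' - \<nu>') = \<gamma> \<longrightarrow>
      (\<integral>x. exp (- (1/2) * (norm (x - \<nu>))\<^sup>2) \<partial>gaussian \<mu>)
      = (\<integral>x. exp (- (1/2) * (norm (x - \<nu>'))\<^sup>2) \<partial>gaussian \<mu>')"
    by (intro allI impI gaussian_kernel_expectation_cong) (simp only: assms)
next
  fix a
  assume "\<forall>(\<mu> :: real ^ 'n) \<nu>. norm (\<mu> - \<nu>) = \<gamma> \<longrightarrow>
      a = (\<integral>x. exp (- (1/2) * (norm (x - \<nu>))\<^sup>2) \<partial>gaussian \<mu>)"
  then show "a = (\<integral>x. exp (- (1/2) * (norm (x - \<nu>))\<^sup>2) \<partial>gaussian \<mu>)"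
    using assms by (elim allE impE)
qed

end

theory Submission
  imports Defs
begin

text \<open>By linearity the two expectations are averages of the kernel expectations
  \<open>A\<^sub>\<gamma>\<close> over pairs of centres. The blocks are disjoint, so the centres are pairwise
  orthogonal of norm \<open>r\<close>: a pair \<open>i \<noteq> j\<close> contributes \<open>\<gamma> = \<surd>2 r\<close>, a pair
  \<open>i = j\<close> contributes \<open>\<gamma> = 0\<close>, and the origin is at distance \<open>r\<close> from every centre.\<close>

text \<open>Kept real-valued, without \<open>ennreal\<close>, so that Bochner integrals against
  \<open>gaussian\<close> turn into \<open>lborel\<close> integrals of real products.\<close>

definition gaussian_density :: "real ^ 'n \<Rightarrow> real ^ 'n \<Rightarrow> real" where
  "gaussian_density \<mu> x =
     (2 * pi) powr (- real CARD('n) / 2) * exp (- (1/2) * (norm (x - \<mu>))\<^sup>2)"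

lemma gaussian_density_nonneg [simp]: "0 \<le> gaussian_density \<mu> x"
  by (simp add: gaussian_density_def)

lemma borel_measurable_gaussian_density [measurable]:
  "gaussian_density \<mu> \<in> borel_measurable borel"
  unfolding gaussian_density_def by measurable

lemma gaussian_eq_density: "gaussian \<mu> = density lborel (\<lambda>x. ennreal (gaussian_density \<mu> x))"
  by (simp add: gaussian_def gaussian_density_def)

lemma integral_gaussian:
  fixes f :: "real ^ 'n \<Rightarrow> real"
  assumes "f \<in> borel_measurable borel"
  shows "(\<integral>x. f x \<partial>gaussian \<mu>) = (\<integral>x. gaussian_density \<mu> x * f x \<partial>lborel)"
  using assms unfolding gaussian_eq_density by (subst integral_density) auto

text \<open>The kernel is a product of one-dimensional Gaussians in the coordinates, so its integral
  factors into finitely many finite integrals. This supplies the integrability behind every later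
  exchange of sum and integral.\<close>

lemma nn_integral_exp_norm_sq_finite:
  fixes \<mu> :: "'a::euclidean_space"
  shows "(\<integral>\<^sup>+x. ennreal (exp (- (1/2) * (norm (x - \<mu>))\<^sup>2)) \<partial>lborel) < \<infinity>"
proof -
  have one_dim: "(\<integral>\<^sup>+t. ennreal (exp (- (1/2) * (t - m)\<^sup>2)) \<partial>lborel) < \<infinity>" for m :: real
  proof -
    \<comment> \<open>The factor \<open>sqrt (2 * pi)\<close> cancels the normalising constant of
      the density with standard deviation 1.\<close>
    have "integrable lborel (\<lambda>t. sqrt (2 * pi) * normal_density m 1 t)"
      by (intro integrable_mult_right integrable_normal_density) simp
    then have "integrable lborel (\<lambda>t. exp (- (1/2) * (t - m)\<^sup>2))"
      by (simp add: normal_density_def)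
    then show ?thesis
      by (simp add: integrable_iff_bounded)
  qed
  have "(norm (x - \<mu>))\<^sup>2 = (\<Sum>b\<in>Basis. (x \<bullet> b - \<mu> \<bullet> b)\<^sup>2)" for x :: 'a
    unfolding power2_norm_eq_inner euclidean_inner[of "x - \<mu>" "x - \<mu>"]
    by (simp add: inner_diff_left power2_eq_square)
  then have "exp (- (1/2) * (norm (x - \<mu>))\<^sup>2) = (\<Prod>b\<in>Basis. exp (- (1/2) * (x \<bullet> b - \<mu> \<bullet> b)\<^sup>2))"
    for x :: 'a
    by (simp only: sum_distrib_left exp_sum finite_Basis)
  then have "(\<integral>\<^sup>+x. ennreal (exp (- (1/2) * (norm (x - \<mu>))\<^sup>2)) \<partial>lborel)
      = (\<integral>\<^sup>+x. (\<Prod>b\<in>Basis. ennreal (exp (- (1/2) * (x \<bullet> b - \<mu> \<bullet> b)\<^sup>2))) \<partial>lborel)"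
    by (simp add: prod_ennreal)
  also have "\<dots> = (\<Prod>b\<in>Basis. \<integral>\<^sup>+t. ennreal (exp (- (1/2) * (t - \<mu> \<bullet> b)\<^sup>2)) \<partial>lborel)"
    by (rule nn_integral_lborel_prod) auto
  also have "\<dots> < \<infinity>"
    using one_dim by (simp add: less_top[symmetric] ennreal_prod_eq_top)
  finally show ?thesis .
qed

lemma integrable_gaussian_density: "integrable lborel (gaussian_density \<mu>)"
  using nn_integral_exp_norm_sq_finite[of \<mu>]
  unfolding gaussian_density_def by (intro integrable_mult_right integrableI_bounded) auto

text \<open>The exponential factor is at most 1, so the Gaussian density itself dominates the
  product.\<close>

lemma integrable_gaussian_density_exp:
  "integrable lborel (\<lambda>x. gaussian_density \<mu> x * exp (- (1/2) * (norm (x - \<nu>))\<^sup>2))"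
proof (rule Bochner_Integration.integrable_bound[OF integrable_gaussian_density[of \<mu>]])
  show "AE x in lborel. norm (gaussian_density \<mu> x * exp (- (1/2) * (norm (x - \<nu>))\<^sup>2))
      \<le> norm (gaussian_density \<mu> x)"
    by (auto simp: abs_mult intro!: mult_left_le)
qed measurable

lemma borel_measurable_ES [measurable]: "ES k \<mu> \<in> borel_measurable borel"
  unfolding ES_def by measurable

lemma integrable_gaussian_density_ES: "integrable lborel (\<lambda>x. gaussian_density m x * ES k \<mu> x)"
  unfolding ES_def sum_distrib_left
  by (intro Bochner_Integration.integrable_sum integrable_gaussian_density_exp)

text \<open>Linearity splits the score into kernels. The expectation of the kernel at
  \<open>\<mu> i\<close> involves just the pair \<open>m\<close>, \<open>\<mu> i\<close>, so it is
  the value of \<open>A_gamma\<close> at their distance.\<close>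

lemma integral_ES_gaussian:
  fixes m :: "real ^ 'n"
  shows "(\<integral>x. ES k \<mu> x \<partial>gaussian m) = (\<Sum>i=1..k. A_gamma TYPE('n) (norm (m - \<mu> i)))"
proof -
  have "(\<integral>x. ES k \<mu> x \<partial>gaussian m) = (\<integral>x. gaussian_density m x * ES k \<mu> x \<partial>lborel)"
    by (intro integral_gaussian) measurable
  also have "\<dots> = (\<Sum>i=1..k. \<integral>x. gaussian_density m x * exp (- (1/2) * (norm (x - \<mu> i))\<^sup>2) \<partial>lborel)"
    unfolding ES_def sum_distrib_left
    by (intro Bochner_Integration.integral_sum integrable_gaussian_density_exp)
  also have "\<dots> = (\<Sum>i=1..k. \<integral>x. exp (- (1/2) * (norm (x - \<mu> i))\<^sup>2) \<partial>gaussian m)"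
    by (intro sum.cong refl integral_gaussian[symmetric]) measurable
  finally show ?thesis
    by (simp only: A_gamma_eq[OF refl])
qed

text \<open>The mixture is defined only through its values on sets; an explicit density makes
  integration against it a matter of \<open>integral_density\<close>. For \<open>k = 0\<close> both
  sides are the zero measure, as \<open>1 / 0 = 0\<close>.\<close>

lemma uniform_mixture_gaussian:
  "uniform_mixture k (\<lambda>i. gaussian (\<mu> i))
     = density lborel (\<lambda>x. ennreal (1 / real k * (\<Sum>i=1..k. gaussian_density (\<mu> i) x)))"
proof (rule measure_eqI)
  fix A assume "A \<in> sets (uniform_mixture k (\<lambda>i. gaussian (\<mu> i)))"
  then have [measurable]: "A \<in> sets borel"
    by simp
  have "emeasure (uniform_mixture k (\<lambda>i. gaussian (\<mu> i))) A
      = ennreal (1 / real k) * (\<Sum>i=1..k. emeasure (gaussian (\<mu> i)) A)"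
    by (rule emeasure_uniform_mixture) (auto simp: gaussian_eq_density)
  also have "\<dots> = ennreal (1 / real k) *
      (\<integral>\<^sup>+x. (\<Sum>i=1..k. ennreal (gaussian_density (\<mu> i) x) * indicator A x) \<partial>lborel)"
    by (subst nn_integral_sum) (auto simp: gaussian_eq_density emeasure_density)
  also have "\<dots> = (\<integral>\<^sup>+x. ennreal (1 / real k) *
      (\<Sum>i=1..k. ennreal (gaussian_density (\<mu> i) x) * indicator A x) \<partial>lborel)"
    by (rule nn_integral_cmult[symmetric]) measurable
  also have "\<dots> = (\<integral>\<^sup>+x. ennreal (1 / real k * (\<Sum>i=1..k. gaussian_density (\<mu> i) x))
      * indicator A x \<partial>lborel)"
    by (intro nn_integral_cong)
      (simp add: ennreal_mult sum_nonneg sum_ennreal sum_distrib_right[symmetric] mult.assoc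
        del: times_divide_eq_left)
  also have "\<dots> = emeasure (density lborel
      (\<lambda>x. ennreal (1 / real k * (\<Sum>i=1..k. gaussian_density (\<mu> i) x)))) A"
    by (rule emeasure_density[symmetric]) measurable
  finally show "emeasure (uniform_mixture k (\<lambda>i. gaussian (\<mu> i))) A = \<dots>" .
qed simp

lemma integral_ES_uniform_mixture:
  "(\<integral>x. ES n \<mu> x \<partial>uniform_mixture k (\<lambda>i. gaussian (m i)))
     = 1 / real k * (\<Sum>i=1..k. \<integral>x. ES n \<mu> x \<partial>gaussian (m i))"
proof -
  have "(\<integral>x. ES n \<mu> x \<partial>uniform_mixture k (\<lambda>i. gaussian (m i)))
      = (\<integral>x. 1 / real k * (\<Sum>i=1..k. gaussian_density (m i) x) * ES n \<mu> x \<partial>lborel)"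
    unfolding uniform_mixture_gaussian
    by (subst integral_density) (auto simp: sum_nonneg)
  also have "\<dots> = 1 / real k * (\<integral>x. (\<Sum>i=1..k. gaussian_density (m i) x * ES n \<mu> x) \<partial>lborel)"
    by (simp add: sum_distrib_right)
  also have "(\<integral>x. (\<Sum>i=1..k. gaussian_density (m i) x * ES n \<mu> x) \<partial>lborel)
      = (\<Sum>i=1..k. \<integral>x. gaussian_density (m i) x * ES n \<mu> x \<partial>lborel)"
    by (intro Bochner_Integration.integral_sum integrable_gaussian_density_ES)
  also have "\<dots> = (\<Sum>i=1..k. \<integral>x. ES n \<mu> x \<partial>gaussian (m i))"
    by (intro sum.cong refl integral_gaussian[symmetric]) measurable
  finally show ?thesis .
qed

text \<open>For \<open>i < j\<close> the earlier block ends at \<open>i * s\<close>, which is at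
  most \<open>(j - 1) * s\<close>, one below the start of the later block. With truncated
  subtraction, index 0 gives the empty block \<open>{1..0}\<close>.\<close>

lemma blocks_disjoint:
  fixes i j s :: nat
  assumes "i \<noteq> j"
  shows "{(i - 1) * s + 1..i * s} \<inter> {(j - 1) * s + 1..j * s} = {}"
proof -
  have "{(i - 1) * s + 1..i * s} \<inter> {(j - 1) * s + 1..j * s} = {}" if "i < j" for i j
  proof -
    have "i * s \<le> (j - 1) * s"
      using that by (intro mult_right_mono) auto
    then have "x \<notin> {(j - 1) * s + 1..j * s}" if "x \<in> {(i - 1) * s + 1..i * s}" for x
      using that unfolding atLeastAtMost_iff by linarith
    then show ?thesis
      by blast
  qed
  then show ?thesis
    using assms by (metis Int_commute linorder_neqE_nat)
qed

text \<open>Pythagoras: the cross term in the squared norm vanishes.\<close>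

lemma norm_diff_orthogonal:
  fixes u v :: "'a::real_inner"
  assumes "u \<bullet> v = 0" "norm u = r" "norm v = r"
  shows "norm (u - v) = sqrt 2 * r"
proof -
  have "(norm (u - v))\<^sup>2 = (norm u)\<^sup>2 + (norm v)\<^sup>2"
    using assms(1) by (simp add: power2_norm_eq_inner inner_diff inner_commute)
  also have "\<dots> = (sqrt 2 * r)\<^sup>2"
    using assms by (simp add: power_mult_distrib)
  finally show ?thesis
    \<comment> \<open>Taking square roots needs \<open>0 \<le> r\<close>, which holds because
      \<open>r\<close> is the norm of \<open>u\<close>.\<close>
    by (rule power2_eq_imp_eq) (use assms(2) in auto)
qed

theorem proposition2:
  fixes k s :: nat and r :: real
    and pos :: "'n::finite \<Rightarrow> nat"
    and \<nu> \<mu> :: "nat \<Rightarrow> real ^ 'n"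
  assumes pos: "bij_betw pos UNIV {1..CARD('n)}"
    and k: "1 \<le> k" "k \<le> CARD('n)"
    and r: "r > 0"
    and s: "s = nat \<lfloor>real CARD('n) / real k\<rfloor>"
    and unit: "\<And>i. i \<in> {1..k} \<Longrightarrow> norm (\<nu> i) = 1"
    and block: "\<And>i j j'. i \<in> {1..k} \<Longrightarrow> pos j \<in> {(i - 1) * s + 1..i * s} \<Longrightarrow>
                  pos j' \<in> {(i - 1) * s + 1..i * s} \<Longrightarrow> \<nu> i $ j = \<nu> i $ j'"
    and zero: "\<And>i j. i \<in> {1..k} \<Longrightarrow> pos j \<notin> {(i - 1) * s + 1..i * s} \<Longrightarrow> \<nu> i $ j = 0"
    and \<mu>: "\<And>i. i \<in> {1..k} \<Longrightarrow> \<mu> i = r *\<^sub>R \<nu> i"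
  shows "(\<integral>x. ES k \<mu> x \<partial>uniform_mixture k (\<lambda>i. gaussian (\<mu> i))) - (\<integral>x. ES k \<mu> x \<partial>gaussian 0)
       = A_gamma TYPE('n) 0 - A_gamma TYPE('n) r
         + (real k - 1) * (A_gamma TYPE('n) (sqrt 2 * r) - A_gamma TYPE('n) r)"
proof -
  let ?A = "A_gamma TYPE('n)"
  have norm_\<mu>: "norm (\<mu> i) = r" if "i \<in> {1..k}" for i
    using that unit \<mu> r by simp
  have orth: "\<mu> i \<bullet> \<mu> j = 0" if "i \<in> {1..k}" "j \<in> {1..k}" "i \<noteq> j" for i j
  proof -
    \<comment> \<open>Position \<open>pos l\<close> lies in at most one of the two blocks, so at
      least one factor vanishes.\<close>
    have "\<nu> i $ l * \<nu> j $ l = 0" for l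
      using zero[OF that(1), of l] zero[OF that(2), of l] blocks_disjoint[OF that(3), of s]
      by (metis disjoint_iff mult_zero_left mult_zero_right)
    then have "\<nu> i \<bullet> \<nu> j = 0"
      by (simp only: inner_vec_def inner_real_def sum.neutral_const)
    then show ?thesis
      using that \<mu> by simp
  qed
  have ES_in: "(\<integral>x. ES k \<mu> x \<partial>gaussian (\<mu> i)) = ?A 0 + (real k - 1) * ?A (sqrt 2 * r)"
    if i: "i \<in> {1..k}" for i
  proof -
    \<comment> \<open>The diagonal term has distance 0 and is split off; all remaining centres are
      at distance \<open>sqrt 2 * r\<close> by orthogonality.\<close>
    have "(\<Sum>j=1..k. ?A (norm (\<mu> i - \<mu> j)))
        = ?A 0 + (\<Sum>j\<in>{1..k} - {i}. ?A (norm (\<mu> i - \<mu> j)))"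
      using i by (subst sum.remove[of _ i]) auto
    also have "(\<Sum>j\<in>{1..k} - {i}. ?A (norm (\<mu> i - \<mu> j))) = (\<Sum>j\<in>{1..k} - {i}. ?A (sqrt 2 * r))"
      using i by (intro sum.cong refl arg_cong[where f = ?A] norm_diff_orthogonal orth norm_\<mu>) auto
    \<comment> \<open>The cardinality \<open>k - 1\<close> is a natural-number difference;
      \<open>1 \<le> k\<close> lets it agree with \<open>real k - 1\<close>.\<close>
    also have "\<dots> = (real k - 1) * ?A (sqrt 2 * r)"
      using i k by simp
    finally show ?thesis
      by (simp only: integral_ES_gaussian)
  qed
  have "(\<integral>x. ES k \<mu> x \<partial>uniform_mixture k (\<lambda>i. gaussian (\<mu> i)))
      = 1 / real k * (\<Sum>i=1..k. ?A 0 + (real k - 1) * ?A (sqrt 2 * r))"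
    unfolding integral_ES_uniform_mixture using ES_in by simp
  \<comment> \<open>The summand is the same for every component, so averaging over
    \<open>k > 0\<close> components returns it.\<close>
  also have "\<dots> = ?A 0 + (real k - 1) * ?A (sqrt 2 * r)"
    using k by simp
  finally have "(\<integral>x. ES k \<mu> x \<partial>uniform_mixture k (\<lambda>i. gaussian (\<mu> i)))
      = ?A 0 + (real k - 1) * ?A (sqrt 2 * r)" .
  \<comment> \<open>Seen from the origin, each of the \<open>k\<close> centres is at distance
    \<open>r\<close>.\<close>
  moreover have "(\<integral>x. ES k \<mu> x \<partial>gaussian 0) = real k * ?A r"
    unfolding integral_ES_gaussian using norm_\<mu> by simp
  ultimately show ?thesis
    by (simp add: algebra_simps)
qed

end
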